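(* Let $\lambda_1$ be the smallest eigenvalue of the discrete elliptic operator $A$ on the finite element space $V^h$, let $\varphi_1$ be the corresponding normalized eigenfunction, and put $\widetilde{A}:=A-\lambda_1 I$. Let $\tau>0$, let $N$ be a positive integer with $N\tau=T$, let $l,m\ge0$ be integers, let $R_{lm}(z)=P_{lm}(z)/Q_{lm}(z)$ be the Padé approximation of $\exp(-z)$ with numerator of degree $l$ and denominator of degree $m$, and let $w^0\in V^h$. Then the difference scheme $$y^{n+1}=S\,y^n,\quad n=0,1,\dots,N-1,\qquad y^0=w^0,\qquad S=\exp(-\lambda_1\tau)\,R_{lm}(\widetilde{A}\tau),$$ is a fundamental mode exact scheme, i.e. $y_1^{n+1}=\exp(-\lambda_1\tau)\,y_1^n$ for $n=0,1,\dots,N-1$, where $y_1^n=(y^n,\varphi_1)$.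
   Context: Setting. $\Omega\subset\mathbb{R}^d$, $d=2,3$, is a bounded domain with piecewise smooth boundary $\partial\Omega$; $(u,v)=\int_\Omega uv\,d\boldsymbol{x}$ and $\|u\|=(u,u)^{1/2}$ are the scalar product and norm in $L_2(\Omega)$ (real-valued functions). The coefficients $k(\boldsymbol{x}),c(\boldsymbol{x}),\mu(\boldsymbol{x})$ are smooth functions on $\overline\Omega$ with $k\ge\kappa>0$ ($\kappa$ a constant) and $\mu\ge0$. The bilinear form $$a(u,v)=\int_\Omega\big(k\nabla u\cdot\nabla v+c\,u\,v\big)\,d\boldsymbol{x}+\int_{\partial\Omega}\mu\,u\,v\,d\boldsymbol{x}$$ on $H^1(\Omega)$ is symmetric and satisfies $a(u,u)\ge\delta\|u\|^2$ with a constant $\delta$ (of arbitrary sign). $V^h\subset H^1(\Omega)$ is a finite-dimensional (finite element) subspace of dimension $M_h$, equipped with the $L_2(\Omega)$ scalar product and norm. The discrete elliptic operator $A:V^h\to V^h$ is defined by $(Ay,v)=a(y,v)$ for all $y,v\in V^h$; it is self-adjoint. $I$ is the identity operator. The eigenvalues of $A$ are $\lambda_1\le\lambda_2\le\dots\le\lambda_{M_h}$, with $A\varphi_k=\lambda_k\varphi_k$, where the eigenfunctions $\varphi_1,\dots,\varphi_{M_h}$ form an orthonormal basis of $V^h$; for $y\in V^h$ one writes $y=\sum_{k=1}^{M_h}y_k\varphi_k$, $y_k=(y,\varphi_k)$. The scheme approximates the Cauchy problem $\frac{dw}{dt}+Aw=0$, $0<t\le T$, $w(0)=w^0$, on the uniform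 time grid $t^n=n\tau$, where $w^0\in V^h$ is the $L_2$-projection onto $V^h$ of an initial function $u^0\in L_2(\Omega)$. Padé approximation of $\exp(-z)$: $\exp(-z)=R_{lm}(z)+\mathcal{O}(z^{l+m+1})$, $R_{lm}(z)=P_{lm}(z)/Q_{lm}(z)$, where $$P_{lm}(z)=\frac{l!}{(l+m)!}\sum_{k=0}^{l}\frac{(l+m-k)!}{k!\,(l-k)!}(-z)^k,\qquad Q_{lm}(z)=\frac{m!}{(l+m)!}\sum_{k=0}^{m}\frac{(l+m-k)!}{k!\,(m-k)!}z^k .$$ For the self-adjoint operator $\widetilde{A}\ge 0$, $R_{lm}(\widetilde{A}\tau)=Q_{lm}(\widetilde{A}\tau)^{-1}P_{lm}(\widetilde{A}\tau)$. Definition. A two-level scheme for this problem, with solution $y^n=\sum_k y_k^n\varphi_k$, is called a fundamental mode exact scheme if $y_1^{n+1}=\exp(-\lambda_1\tau)\,y_1^n$ for all $n=0,1,\dots,N-1$. *)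

theory Defs
  imports "HOL-Analysis.Analysis" "HOL-Computational_Algebra.Polynomial"
begin

section \<open>Square-integrable functions modulo equality almost everywhere\<close>

definition square_integrable :: "('a::euclidean_space \<Rightarrow> real) \<Rightarrow> bool" where
  "square_integrable f \<longleftrightarrow> f \<in> borel_measurable borel \<and> integrable lborel (\<lambda>x. (f x)\<^sup>2)"

lemma square_integrable_measurable: "square_integrable f \<Longrightarrow> f \<in> borel_measurable borel"
  by (simp add: square_integrable_def)

lemma square_integrable_prod:
  assumes "square_integrable f" "square_integrable g"
  shows "integrable lborel (\<lambda>x. f x * g x)"
proof (rule Bochner_Integration.integrable_bound)
  show "integrable lborel (\<lambda>x. (f x)\<^sup>2 + (g x)\<^sup>2)"
    using assms unfolding square_integrable_def by (intro Bochner_Integration.integrable_add) simp_all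
  show "(\<lambda>x. f x * g x) \<in> borel_measurable lborel"
    using assms unfolding square_integrable_def by (simp add: borel_measurable_times)
  have "\<bar>a * b\<bar> \<le> a\<^sup>2 + b\<^sup>2" for a b :: real
  proof -
    have "2 * \<bar>a\<bar> * \<bar>b\<bar> \<le> a\<^sup>2 + b\<^sup>2" using sum_squares_bound[of "\<bar>a\<bar>" "\<bar>b\<bar>"] by simp
    moreover have "0 \<le> \<bar>a\<bar> * \<bar>b\<bar>" by simp
    ultimately show ?thesis unfolding abs_mult by linarith
  qed
  then show "AE x in lborel. norm (f x * g x) \<le> norm ((f x)\<^sup>2 + (g x)\<^sup>2)"
    by simp
qed

lemma square_integrable_zero: "square_integrable (\<lambda>x. 0)"
  by (simp add: square_integrable_def)

lemma square_integrable_add: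
  assumes "square_integrable f" "square_integrable g"
  shows "square_integrable (\<lambda>x. f x + g x)"
proof -
  have "integrable lborel (\<lambda>x. (f x)\<^sup>2 + (g x)\<^sup>2 + 2 * (f x * g x))"
    using assms square_integrable_prod[OF assms]
    by (intro Bochner_Integration.integrable_add integrable_mult_right) (simp_all add: square_integrable_def)
  then have "integrable lborel (\<lambda>x. (f x + g x)\<^sup>2)"
    by (simp add: power2_sum mult.assoc)
  with assms show ?thesis
    unfolding square_integrable_def by (intro conjI borel_measurable_add) auto
qed

lemma square_integrable_scale:
  assumes "square_integrable f"
  shows "square_integrable (\<lambda>x. r * f x)"
  using assms unfolding square_integrable_def power_mult_distrib
  by (intro conjI borel_measurable_times borel_measurable_const integrable_mult_right) auto

lemma square_integrable_uminus:
  assumes "square_integrable f"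
  shows "square_integrable (\<lambda>x. - f x)"
  using square_integrable_scale[OF assms, of "-1"] by simp

lemma square_integrable_diff:
  assumes "square_integrable f" "square_integrable g"
  shows "square_integrable (\<lambda>x. f x - g x)"
  using square_integrable_add[OF assms(1) square_integrable_uminus[OF assms(2)]] by simp

definition eq_ae :: "('a::euclidean_space \<Rightarrow> real) \<Rightarrow> ('a \<Rightarrow> real) \<Rightarrow> bool" where
  "eq_ae f g \<longleftrightarrow> square_integrable f \<and> square_integrable g \<and> (AE x in lborel. f x = g x)"

lemma part_equivp_eq_ae: "part_equivp eq_ae"
proof (rule part_equivpI)
  show "\<exists>f::'a \<Rightarrow> real. eq_ae f f"
    by (rule exI[of _ "\<lambda>x. 0"]) (simp add: eq_ae_def square_integrable_zero)
  show "symp (eq_ae :: ('a \<Rightarrow> real) \<Rightarrow> _)"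
    by (auto simp: symp_def eq_ae_def elim: eventually_mono)
  show "transp (eq_ae :: ('a \<Rightarrow> real) \<Rightarrow> _)"
    unfolding transp_def eq_ae_def by (auto elim: eventually_elim2)
qed

quotient_type (overloaded) 'a l2 = "'a::euclidean_space \<Rightarrow> real" / partial: eq_ae
  morphisms rep_l2 abs_l2
  by (rule part_equivp_eq_ae)

instantiation l2 :: (euclidean_space) real_vector
begin

lift_definition zero_l2 :: "'a l2" is "\<lambda>x. 0"
  by (simp add: eq_ae_def square_integrable_zero)

lift_definition plus_l2 :: "'a l2 \<Rightarrow> 'a l2 \<Rightarrow> 'a l2" is "\<lambda>f g x. f x + g x"
  by (auto simp: eq_ae_def square_integrable_add elim: eventually_elim2)

lift_definition uminus_l2 :: "'a l2 \<Rightarrow> 'a l2" is "\<lambda>f x. - f x"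
  by (auto simp: eq_ae_def square_integrable_uminus elim: eventually_mono)

lift_definition minus_l2 :: "'a l2 \<Rightarrow> 'a l2 \<Rightarrow> 'a l2" is "\<lambda>f g x. f x - g x"
  by (auto simp: eq_ae_def square_integrable_diff elim: eventually_elim2)

lift_definition scaleR_l2 :: "real \<Rightarrow> 'a l2 \<Rightarrow> 'a l2" is "\<lambda>r f x. r * f x"
  by (auto simp: eq_ae_def square_integrable_scale elim: eventually_mono)

instance
proof
  fix u v w :: "'a l2" and r s :: real
  show "u + v + w = u + (v + w)"
    by transfer (auto simp: eq_ae_def square_integrable_add add.assoc)
  show "u + v = v + u"
    by transfer (auto simp: eq_ae_def square_integrable_add add.commute)
  show "0 + u = u"
    by transfer (auto simp: eq_ae_def)
  show "- u + u = 0"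
    by transfer (auto simp: eq_ae_def square_integrable_zero)
  show "u - v = u + - v"
    by transfer (auto simp: eq_ae_def square_integrable_diff)
  show "r *\<^sub>R (u + v) = r *\<^sub>R u + r *\<^sub>R v"
    by transfer (auto simp: eq_ae_def square_integrable_add square_integrable_scale distrib_left)
  show "(r + s) *\<^sub>R u = r *\<^sub>R u + s *\<^sub>R u"
    by transfer (auto simp: eq_ae_def square_integrable_add square_integrable_scale distrib_right)
  show "r *\<^sub>R s *\<^sub>R u = (r * s) *\<^sub>R u"
    by transfer (auto simp: eq_ae_def square_integrable_scale mult.assoc)
  show "1 *\<^sub>R u = u"
    by transfer (auto simp: eq_ae_def)
qed

end

instantiation l2 :: (euclidean_space) real_inner
begin

lift_definition inner_l2 :: "'a l2 \<Rightarrow> 'a l2 \<Rightarrow> real" is "\<lambda>f g. LINT x|lborel. f x * g x"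
proof -
  fix f1 f2 g1 g2 :: "'a \<Rightarrow> real"
  assume "eq_ae f1 f2" "eq_ae g1 g2"
  then show "(LINT x|lborel. f1 x * g1 x) = (LINT x|lborel. f2 x * g2 x)"
    unfolding eq_ae_def
    by (intro integral_cong_AE borel_measurable_integrable square_integrable_prod)
       (auto elim: eventually_elim2)
qed

definition norm_l2 :: "'a l2 \<Rightarrow> real" where "norm_l2 u = sqrt (inner u u)"
definition sgn_l2 :: "'a l2 \<Rightarrow> 'a l2" where "sgn_l2 u = u /\<^sub>R norm u"
definition dist_l2 :: "'a l2 \<Rightarrow> 'a l2 \<Rightarrow> real" where "dist_l2 u v = norm (u - v)"
definition uniformity_l2 :: "('a l2 \<times> 'a l2) filter" where
  "uniformity_l2 = (INF e\<in>{0 <..}. principal {(u, v). dist u v < e})"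
definition open_l2 :: "'a l2 set \<Rightarrow> bool" where
  "open_l2 S = (\<forall>u\<in>S. \<forall>\<^sub>F (u', v) in uniformity. u' = u \<longrightarrow> v \<in> S)"

instance
proof
  fix u v w :: "'a l2" and r :: real
  show "dist u v = norm (u - v)" by (simp add: dist_l2_def)
  show "sgn u = u /\<^sub>R norm u" by (simp add: sgn_l2_def)
  show "(uniformity :: ('a l2 \<times> 'a l2) filter) = (INF e\<in>{0 <..}. principal {(u, v). dist u v < e})"
    by (simp add: uniformity_l2_def)
  show "open S \<longleftrightarrow> (\<forall>u\<in>S. \<forall>\<^sub>F (u', v) in uniformity. u' = u \<longrightarrow> v \<in> S)" for S :: "'a l2 set"
    by (simp add: open_l2_def)
  show "inner u v = inner v u"
    by transfer (simp add: mult.commute)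
  show "inner (u + v) w = inner u w + inner v w"
    by transfer (auto simp: eq_ae_def distrib_right square_integrable_prod)
  show "inner (r *\<^sub>R u) v = r * inner u v"
    by transfer (simp add: mult.assoc)
  show "0 \<le> inner u u"
    by transfer simp
  show "inner u u = 0 \<longleftrightarrow> u = 0"
  proof transfer
    fix f :: "'a \<Rightarrow> real"
    assume f: "eq_ae f f"
    have "(LINT x|lborel. f x * f x) = 0 \<longleftrightarrow> (AE x in lborel. f x * f x = 0)"
      by (rule integral_nonneg_eq_0_iff_AE)
         (use f in \<open>auto simp: eq_ae_def intro: square_integrable_prod\<close>)
    then show "(LINT x|lborel. f x * f x) = 0 \<longleftrightarrow> eq_ae f (\<lambda>x. 0)"
      using f by (simp add: eq_ae_def square_integrable_zero)
  qed
  show "norm u = sqrt (inner u u)" by (simp add: norm_l2_def)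
qed

end

lemma square_integrable_rep_l2: "square_integrable (rep_l2 u)"
  using Quotient_rep_reflp[OF Quotient_l2, of u] by (simp add: eq_ae_def)

lemma inner_l2_rep: "inner u v = (LINT x|lborel. rep_l2 u x * rep_l2 v x)"
  by (simp add: inner_l2.rep_eq)

text \<open>\<open>L2 D\<close> is \<open>L\<^sub>2(D)\<close>, its elements being extended by zero outside \<open>D\<close>.  With this encoding
  the scalar product and the norm of \<open>L\<^sub>2(D)\<close> are the ones of the type \<^typ>\<open>'a l2\<close>.\<close>

definition L2 :: "'a::euclidean_space set \<Rightarrow> 'a l2 set" where
  "L2 D = {u. AE x in lborel. x \<notin> D \<longrightarrow> rep_l2 u x = 0}"


section \<open>Smooth functions and piecewise smooth boundaries\<close>

text \<open>\<open>C\<^sup>k\<close> on an open set, by iterated directional derivatives.\<close>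

primrec Ck_on :: "nat \<Rightarrow> 'a::euclidean_space set \<Rightarrow> ('a \<Rightarrow> 'b::real_normed_vector) \<Rightarrow> bool" where
  "Ck_on 0 U f \<longleftrightarrow> continuous_on U f"
| "Ck_on (Suc k) U f \<longleftrightarrow> (\<forall>x\<in>U. f differentiable (at x)) \<and>
     (\<forall>v. Ck_on k U (\<lambda>x. frechet_derivative f (at x) v))"

definition smooth_near :: "'a::euclidean_space set \<Rightarrow> ('a \<Rightarrow> 'b::real_normed_vector) \<Rightarrow> bool" where
  "smooth_near S f \<longleftrightarrow> (\<exists>U. open U \<and> S \<subseteq> U \<and> (\<forall>k. Ck_on k U f))"

text \<open>A smooth piece of hypersurface is the image of a polytope \<open>Q\<close> of dimension \<open>d - 1\<close> under a
  map that is smooth up to the relative boundary of \<open>Q\<close> and a regular injective parametrization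
  of the relative interior; degeneration at the relative boundary is allowed (as at the apex of a
  cone).\<close>

definition smooth_piece :: "'a::euclidean_space set \<Rightarrow> ('a \<Rightarrow> 'a) \<Rightarrow> bool" where
  "smooth_piece Q \<Phi> \<longleftrightarrow> polytope Q \<and> aff_dim Q = int DIM('a) - 1 \<and> smooth_near Q \<Phi> \<and>
     inj_on \<Phi> (rel_interior Q) \<and>
     (\<forall>x\<in>rel_interior Q. inj_on (frechet_derivative \<Phi> (at x)) {y - x | y. y \<in> affine hull Q})"

definition piecewise_smooth_boundary :: "'a::euclidean_space set \<Rightarrow> bool" where
  "piecewise_smooth_boundary D \<longleftrightarrow> (\<exists>(n::nat) Q \<Phi>.
     (\<forall>i<n. smooth_piece (Q i) (\<Phi> i)) \<and>
     frontier D = (\<Union>i<n. \<Phi> i ` Q i) \<and>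
     (\<forall>i<n. \<forall>j<n. i \<noteq> j \<longrightarrow> \<Phi> i ` rel_interior (Q i) \<inter> \<Phi> j ` rel_interior (Q j) = {}))"


section \<open>Surface measure\<close>

text \<open>The \<open>s\<close>-dimensional Hausdorff measure, normalized so that it is the Euclidean
  \<open>s\<close>-dimensional area on \<open>s\<close>-dimensional surfaces.  It is countably additive on
  Borel sets (\<open>emeasure_hausdorff_measure\<close> below), so \<open>measure_of\<close> does not degenerate.\<close>

definition hausdorff_gauge :: "nat \<Rightarrow> 'a::euclidean_space set \<Rightarrow> ennreal" where
  "hausdorff_gauge s C =
     (if C = {} then 0 else ennreal (unit_ball_vol (real s) * (diameter C / 2) ^ s))"

definition hausdorff_pre :: "nat \<Rightarrow> real \<Rightarrow> 'a::euclidean_space set \<Rightarrow> ennreal" where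
  "hausdorff_pre s \<delta> S =
     (INF C \<in> {C :: nat \<Rightarrow> 'a set. S \<subseteq> (\<Union>i. C i) \<and> (\<forall>i. bounded (C i) \<and> diameter (C i) \<le> \<delta>)}.
        \<Sum>i. hausdorff_gauge s (C i))"

definition hausdorff_outer :: "nat \<Rightarrow> 'a::euclidean_space set \<Rightarrow> ennreal" where
  "hausdorff_outer s S = (SUP \<delta> \<in> {0<..}. hausdorff_pre s \<delta> S)"

definition hausdorff_measure :: "nat \<Rightarrow> 'a::euclidean_space measure" where
  "hausdorff_measure s = measure_of UNIV (sets borel) (hausdorff_outer s)"

lemma hausdorff_pre_antimono: "\<delta> \<le> \<delta>' \<Longrightarrow> hausdorff_pre s \<delta>' S \<le> hausdorff_pre s \<delta> S"
  unfolding hausdorff_pre_def by (rule INF_superset_mono) (auto intro: order_trans)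

lemma hausdorff_pre_mono: "S \<subseteq> T \<Longrightarrow> hausdorff_pre s \<delta> S \<le> hausdorff_pre s \<delta> T"
  unfolding hausdorff_pre_def by (rule INF_superset_mono) auto

lemma hausdorff_outer_mono: "S \<subseteq> T \<Longrightarrow> hausdorff_outer s S \<le> hausdorff_outer s T"
  unfolding hausdorff_outer_def by (intro SUP_mono) (auto intro: hausdorff_pre_mono)

lemma hausdorff_pre_le_outer: "0 < \<delta> \<Longrightarrow> hausdorff_pre s \<delta> S \<le> hausdorff_outer s S"
  unfolding hausdorff_outer_def by (rule SUP_upper) simp

lemma hausdorff_pre_le:
  assumes "S \<subseteq> (\<Union>i. C i)" "\<And>i. bounded (C i)" "\<And>i. diameter (C i) \<le> \<delta>"
  shows "hausdorff_pre s \<delta> S \<le> (\<Sum>i. hausdorff_gauge s (C i))"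
  unfolding hausdorff_pre_def using assms by (intro INF_lower) auto

lemma hausdorff_outer_empty: "hausdorff_outer s {} = 0"
proof -
  have "hausdorff_pre s \<delta> ({} :: 'a set) \<le> (\<Sum>i::nat. hausdorff_gauge s ({} :: 'a set))"
    if "\<delta> > 0" for \<delta>
    using that by (intro hausdorff_pre_le) auto
  then have "hausdorff_pre s \<delta> ({} :: 'a set) = 0" if "\<delta> > 0" for \<delta>
    using that by (simp add: hausdorff_gauge_def)
  then show ?thesis
    unfolding hausdorff_outer_def by (auto intro!: antisym SUP_least)
qed

lemma hausdorff_pre_subadditive:
  fixes A :: "nat \<Rightarrow> 'a::euclidean_space set"
  shows "hausdorff_pre s \<delta> (\<Union>i. A i) \<le> (\<Sum>i. hausdorff_pre s \<delta> (A i))"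
proof (rule ennreal_le_epsilon)
  fix e :: real assume e: "0 < e" and fin: "(\<Sum>i. hausdorff_pre s \<delta> (A i)) < top"
  then have *: "hausdorff_pre s \<delta> (A n) < hausdorff_pre s \<delta> (A n) + e * (1/2)^Suc n" for n
    by (auto simp add: less_top dest!: ennreal_suminf_lessD)
  have "\<exists>B :: nat \<Rightarrow> 'a set. A n \<subseteq> (\<Union>i. B i) \<and> (\<forall>i. bounded (B i) \<and> diameter (B i) \<le> \<delta>) \<and>
     (\<Sum>i. hausdorff_gauge s (B i)) \<le> hausdorff_pre s \<delta> (A n) + e * (1/2)^Suc n" for n
    using *[of n] unfolding hausdorff_pre_def[of _ _ "A n"] INF_less_iff by (auto intro: less_imp_le)
  then obtain B :: "nat \<Rightarrow> nat \<Rightarrow> 'a set" where B: "\<And>n. A n \<subseteq> (\<Union>i. B n i)"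
     "\<And>n i. bounded (B n i)" "\<And>n i. diameter (B n i) \<le> \<delta>"
     "\<And>n. (\<Sum>i. hausdorff_gauge s (B n i)) \<le> hausdorff_pre s \<delta> (A n) + e * (1/2)^Suc n"
    by metis
  define C where "C = case_prod B \<circ> prod_decode"
  have "(\<Union>i. A i) \<subseteq> (\<Union>i. C i)"
    using B(1) by (auto simp add: C_def subset_eq) (metis prod.case prod_encode_inverse)
  then have "hausdorff_pre s \<delta> (\<Union>i. A i) \<le> (\<Sum>i. hausdorff_gauge s (C i))"
    by (rule hausdorff_pre_le) (auto simp: C_def split_def B)
  also have "\<dots> = (\<Sum>n. \<Sum>i. hausdorff_gauge s (B n i))"
    unfolding C_def comp_def by (intro suminf_ennreal_2dimen) auto
  also have "\<dots> \<le> (\<Sum>n. hausdorff_pre s \<delta> (A n) + e * (1/2) ^ Suc n)"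
    by (intro suminf_le B(4)) auto
  also have "\<dots> = (\<Sum>n. hausdorff_pre s \<delta> (A n)) + (\<Sum>n. ennreal e * ennreal ((1/2) ^ Suc n))"
    using e by (subst suminf_add[symmetric])
               (auto simp del: ennreal_suminf_cmult simp add: ennreal_mult[symmetric])
  also have "\<dots> = (\<Sum>n. hausdorff_pre s \<delta> (A n)) + e"
    unfolding ennreal_suminf_cmult
    by (subst suminf_ennreal_eq[OF zero_le_power power_half_series]) auto
  finally show "hausdorff_pre s \<delta> (\<Union>i. A i) \<le> (\<Sum>i. hausdorff_pre s \<delta> (A i)) + e" .
qed

lemma hausdorff_outer_subadditive:
  "hausdorff_outer s (\<Union>i::nat. A i) \<le> (\<Sum>i. hausdorff_outer s (A i))"
  unfolding hausdorff_outer_def[of s "\<Union>i. A i"]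
proof (rule SUP_least)
  fix \<delta> :: real assume "\<delta> \<in> {0<..}"
  then have "(\<Sum>i. hausdorff_pre s \<delta> (A i)) \<le> (\<Sum>i. hausdorff_outer s (A i))"
    by (intro suminf_le hausdorff_pre_le_outer) auto
  with hausdorff_pre_subadditive[of s \<delta> A]
  show "hausdorff_pre s \<delta> (\<Union>i. A i) \<le> (\<Sum>i. hausdorff_outer s (A i))" by (rule order_trans)
qed

lemma hausdorff_outer_Un: "hausdorff_outer s (X \<union> Y) \<le> hausdorff_outer s X + hausdorff_outer s Y"
proof -
  let ?Z = "\<lambda>i::nat. if i = 0 then X else if i = 1 then Y else {}"
  have "X \<union> Y \<subseteq> (\<Union>i. ?Z i)"
  proof
    fix x assume "x \<in> X \<union> Y"
    then have "x \<in> ?Z 0 \<or> x \<in> ?Z 1" by auto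
    then show "x \<in> (\<Union>i. ?Z i)" by blast
  qed
  then have "hausdorff_outer s (X \<union> Y) \<le> hausdorff_outer s (\<Union>i. ?Z i)"
    by (rule hausdorff_outer_mono)
  also have "\<dots> \<le> (\<Sum>i. hausdorff_outer s (?Z i))"
    by (rule hausdorff_outer_subadditive)
  also have "\<dots> = (\<Sum>i<2. hausdorff_outer s (?Z i))"
    by (rule suminf_finite) (auto simp: hausdorff_outer_empty)
  finally show ?thesis
    by (simp add: lessThan_Suc numeral_2_eq_2 add.commute)
qed

lemma hausdorff_outer_metric:
  fixes X Y :: "'a::euclidean_space set"
  assumes "\<epsilon> > 0" and sep: "\<And>x y. x \<in> X \<Longrightarrow> y \<in> Y \<Longrightarrow> \<epsilon> \<le> dist x y"
  shows "hausdorff_outer s X + hausdorff_outer s Y \<le> hausdorff_outer s (X \<union> Y)"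
proof -
  have *: "hausdorff_pre s \<delta> X + hausdorff_pre s \<delta> Y \<le> hausdorff_pre s \<delta> (X \<union> Y)" if "\<delta> < \<epsilon>" for \<delta>
    unfolding hausdorff_pre_def[of _ _ "X \<union> Y"]
  proof (rule INF_greatest, clarify)
    fix C :: "nat \<Rightarrow> 'a set"
    assume C: "X \<union> Y \<subseteq> (\<Union>i. C i)" "\<forall>i. bounded (C i) \<and> diameter (C i) \<le> \<delta>"
    have meet: "C i \<inter> X = {} \<or> C i \<inter> Y = {}" for i
    proof (rule ccontr)
      assume "\<not> ?thesis"
      then obtain x y where "x \<in> C i" "x \<in> X" "y \<in> C i" "y \<in> Y" by auto
      then have "\<epsilon> \<le> dist x y" "dist x y \<le> diameter (C i)"
        using sep C(2) by (auto intro: diameter_bounded_bound)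
      with C(2) \<open>\<delta> < \<epsilon>\<close> show False by (meson not_less order_trans)
    qed
    have d0: "0 \<le> \<delta>" using C(2) diameter_ge_0 order_trans by blast
    let ?P = "\<lambda>Z i. if C i \<inter> Z = {} then {} else C i"
    have pre: "hausdorff_pre s \<delta> Z \<le> (\<Sum>i. hausdorff_gauge s (?P Z i))" if "Z \<subseteq> X \<union> Y" for Z
    proof (rule hausdorff_pre_le)
      show "Z \<subseteq> (\<Union>i. ?P Z i)"
      proof
        fix z assume "z \<in> Z"
        with that C(1) obtain i where "z \<in> C i" by blast
        with \<open>z \<in> Z\<close> have "z \<in> ?P Z i" by auto
        then show "z \<in> (\<Union>i. ?P Z i)" by blast
      qed
    qed (use C(2) d0 in auto)
    have "hausdorff_pre s \<delta> X + hausdorff_pre s \<delta> Y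
       \<le> (\<Sum>i. hausdorff_gauge s (?P X i)) + (\<Sum>i. hausdorff_gauge s (?P Y i))"
      by (intro add_mono pre) auto
    also have "\<dots> = (\<Sum>i. hausdorff_gauge s (?P X i) + hausdorff_gauge s (?P Y i))"
      by (rule suminf_add) auto
    also have "\<dots> \<le> (\<Sum>i. hausdorff_gauge s (C i))"
    proof (intro suminf_le)
      show "hausdorff_gauge s (?P X i) + hausdorff_gauge s (?P Y i) \<le> hausdorff_gauge s (C i)" for i
        using meet[of i] by (auto simp: hausdorff_gauge_def)
    qed auto
    finally show "hausdorff_pre s \<delta> X + hausdorff_pre s \<delta> Y \<le> (\<Sum>i. hausdorff_gauge s (C i))" .
  qed
  have "hausdorff_pre s \<delta> X + hausdorff_pre s \<delta>' Y \<le> hausdorff_outer s (X \<union> Y)"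
    if "0 < \<delta>" "0 < \<delta>'" for \<delta> \<delta>'
  proof -
    let ?d = "min (min \<delta> \<delta>') (\<epsilon> / 2)"
    have "hausdorff_pre s \<delta> X + hausdorff_pre s \<delta>' Y \<le> hausdorff_pre s ?d X + hausdorff_pre s ?d Y"
      by (intro add_mono hausdorff_pre_antimono) auto
    also have "\<dots> \<le> hausdorff_pre s ?d (X \<union> Y)" using \<open>\<epsilon> > 0\<close> by (intro *) auto
    also have "\<dots> \<le> hausdorff_outer s (X \<union> Y)"
      using that \<open>\<epsilon> > 0\<close> by (intro hausdorff_pre_le_outer) auto
    finally show ?thesis .
  qed
  then have "(SUP \<delta>'\<in>{0<..}. hausdorff_pre s \<delta> X + hausdorff_pre s \<delta>' Y) \<le> hausdorff_outer s (X \<union> Y)"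
    if "0 < \<delta>" for \<delta>
    using that by (auto intro!: SUP_least)
  then have "hausdorff_pre s \<delta> X + hausdorff_outer s Y \<le> hausdorff_outer s (X \<union> Y)" if "0 < \<delta>" for \<delta>
    using that unfolding hausdorff_outer_def[of s Y] by (simp add: ennreal_SUP_add_right)
  then have "(SUP \<delta>\<in>{0<..}. hausdorff_pre s \<delta> X + hausdorff_outer s Y) \<le> hausdorff_outer s (X \<union> Y)"
    by (auto intro!: SUP_least)
  then show ?thesis
    unfolding hausdorff_outer_def[of s X] by (simp add: ennreal_SUP_add_left)
qed

lemma closed_in_lambda_system_hausdorff:
  fixes F :: "'a::euclidean_space set"
  assumes "closed F"
  shows "F \<in> lambda_system UNIV UNIV (hausdorff_outer s)"
proof -
  let ?H = "hausdorff_outer s :: 'a set \<Rightarrow> ennreal"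
  have le: "?H (X \<inter> F) + ?H (X - F) \<le> ?H X" if "F \<noteq> {}" for X
  proof (cases "?H X = \<infinity>")
    case False
    define d where "d x = infdist x F" for x
    have dpos: "d x > 0" if "x \<notin> F" for x
      using that \<open>closed F\<close> \<open>F \<noteq> {}\<close> infdist_pos_not_in_closed unfolding d_def by blast
    have dlip: "\<bar>d x - d y\<bar> \<le> dist x y" for x y
      unfolding d_def using infdist_triangle_abs[of x F y] by (simp add: dist_commute)
    have dF: "d x = 0" if "x \<in> F" for x using that by (simp add: d_def)
    define E where "E n = {x\<in>X. 1 / real (Suc n) \<le> d x}" for n
    define R where "R n = {x\<in>X. 1 / real (Suc (Suc n)) \<le> d x \<and> d x < 1 / real (Suc n)}" for n
    have sep: "?H (\<Union>k<n. R (2 * k + p)) = (\<Sum>k<n. ?H (R (2 * k + p)))" for n p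
    proof (induction n)
      case 0 then show ?case by (simp add: hausdorff_outer_empty)
    next
      case (Suc n)
      let ?U = "\<Union>k<n. R (2 * k + p)"
      let ?e = "1 / real (2 * n + p) - 1 / real (2 * n + p + 1)"
      have "?H (R (2 * n + p)) + ?H ?U \<le> ?H (R (2 * n + p) \<union> ?U)"
      proof (cases "n = 0")
        case True then show ?thesis by (simp add: hausdorff_outer_empty)
      next
        case False
        show ?thesis
        proof (rule hausdorff_outer_metric[where \<epsilon> = ?e])
          show "?e > 0" using False by (simp add: frac_less2)
          fix x y assume x: "x \<in> R (2 * n + p)" and "y \<in> ?U"
          then obtain k where k: "k < n" "y \<in> R (2 * k + p)" by auto
          have "1 / real (2 * n + p) \<le> 1 / real (Suc (Suc (2 * k + p)))"
            using k(1) by (intro divide_left_mono) auto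
          also have "\<dots> \<le> d y" using k(2) by (simp add: R_def)
          finally have "1 / real (2 * n + p) \<le> d y" .
          moreover have "d x < 1 / real (2 * n + p + 1)" using x by (simp add: R_def)
          ultimately show "?e \<le> dist x y" using dlip[of x y] by linarith
        qed
      qed
      moreover have "R (2 * n + p) \<union> ?U = (\<Union>k<Suc n. R (2 * k + p))" by (auto simp: less_Suc_eq)
      moreover have "?H (R (2 * n + p) \<union> ?U) \<le> ?H (R (2 * n + p)) + ?H ?U" by (rule hausdorff_outer_Un)
      ultimately show ?case using Suc.IH by (simp add: add.commute)
    qed
    have fin: "(\<Sum>k. ?H (R (2 * k + p))) \<le> ?H X" for p
    proof (rule suminf_le_const)
      show "(\<Sum>k<n. ?H (R (2 * k + p))) \<le> ?H X" for n
        unfolding sep[symmetric] by (rule hausdorff_outer_mono) (auto simp: R_def)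
    qed simp
    have key: "?H (X - F) \<le> ?H (E (2 * n)) + ((\<Sum>k. ?H (R (2 * (k + n)))) + (\<Sum>k. ?H (R (2 * (k + n) + 1))))" for n
    proof -
      have "X - F \<subseteq> E (2 * n) \<union> ((\<Union>k. R (2 * (k + n))) \<union> (\<Union>k. R (2 * (k + n) + 1)))"
      proof
        fix x assume x: "x \<in> X - F"
        show "x \<in> E (2 * n) \<union> ((\<Union>k. R (2 * (k + n))) \<union> (\<Union>k. R (2 * (k + n) + 1)))"
        proof (cases "x \<in> E (2 * n)")
          case False
          then have small: "d x < 1 / real (Suc (2 * n))" using x by (auto simp: E_def not_le)
          obtain j where j: "1 / real (Suc j) < d x" using dpos x nat_approx_posE by (metis DiffD2)
          define q where "q = (LEAST q. 1 / real (Suc q) \<le> d x)"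
          have q: "1 / real (Suc q) \<le> d x" unfolding q_def by (rule LeastI[of _ j]) (use j in auto)
          have q': "d x < 1 / real (Suc i)" if "i < q" for i
            using not_less_Least[of i "\<lambda>q. 1 / real (Suc q) \<le> d x"] that unfolding q_def by auto
          have "2 * n < q"
          proof (rule ccontr)
            assume "\<not> ?thesis"
            then have "1 / real (Suc (2 * n)) \<le> 1 / real (Suc q)" by (intro divide_left_mono) auto
            with q small show False by linarith
          qed
          then obtain r where r: "q = Suc r" "2 * n \<le> r" by (cases q) auto
          have xr: "x \<in> R r" using q q'[of r] r x by (auto simp: R_def)
          have "r = 2 * ((r div 2 - n) + n) \<or> r = 2 * ((r div 2 - n) + n) + 1" using r(2) by presburger
          with xr show ?thesis by (metis UN_I UNIV_I UnI1 UnI2)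
        qed simp
      qed
      then have "?H (X - F) \<le> ?H (E (2 * n) \<union> ((\<Union>k. R (2 * (k + n))) \<union> (\<Union>k. R (2 * (k + n) + 1))))"
        by (rule hausdorff_outer_mono)
      also have "\<dots> \<le> ?H (E (2 * n)) + (?H (\<Union>k. R (2 * (k + n))) + ?H (\<Union>k. R (2 * (k + n) + 1)))"
        by (meson add_left_mono hausdorff_outer_Un order_trans)
      also have "\<dots> \<le> ?H (E (2 * n)) + ((\<Sum>k. ?H (R (2 * (k + n)))) + (\<Sum>k. ?H (R (2 * (k + n) + 1))))"
        by (intro add_mono hausdorff_outer_subadditive order_refl)
      finally show ?thesis .
    qed
    have EF: "?H (X \<inter> F) + ?H (E n) \<le> ?H X" for n
    proof -
      have "?H (X \<inter> F) + ?H (E n) \<le> ?H ((X \<inter> F) \<union> E n)"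
      proof (rule hausdorff_outer_metric[where \<epsilon> = "1 / real (Suc n)"])
        fix x y assume "x \<in> X \<inter> F" "y \<in> E n"
        then show "1 / real (Suc n) \<le> dist x y"
          using dlip[of x y] dF[of x] by (auto simp: E_def)
      qed simp
      also have "\<dots> \<le> ?H X" by (rule hausdorff_outer_mono) (auto simp: E_def)
      finally show ?thesis .
    qed
    have tail: "(\<lambda>n. \<Sum>k. ?H (R (2 * (k + n) + p))) \<longlonglongrightarrow> 0" for p
    proof -
      define a where "a k = enn2real (?H (R (2 * k + p)))" for k
      have sfin: "(\<Sum>k. ?H (R (2 * k + p))) \<noteq> \<infinity>" using fin[of p] False by (auto simp: top_unique)
      have Ha: "?H (R (2 * k + p)) = ennreal (a k)" for k
        using ennreal_suminf_lessD[of "\<lambda>k. ?H (R (2 * k + p))" top k] sfin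
        by (auto simp: a_def less_top)
      have a0: "0 \<le> a k" for k by (simp add: a_def)
      have sa: "summable a"
        by (rule summable_suminf_not_top[OF a0]) (use sfin in \<open>simp add: Ha\<close>)
      have "(\<lambda>n. \<Sum>k. a (k + n)) \<longlonglongrightarrow> 0"
        using suminf_exist_split2[OF sa] .
      then have "(\<lambda>n. ennreal (\<Sum>k. a (k + n))) \<longlonglongrightarrow> ennreal 0" by (rule tendsto_ennrealI)
      moreover have "(\<Sum>k. ?H (R (2 * (k + n) + p))) = ennreal (\<Sum>k. a (k + n))" for n
        unfolding Ha by (rule suminf_ennreal2) (use a0 sa in \<open>auto simp: summable_iff_shift\<close>)
      ultimately show ?thesis by simp
    qed
    have "(\<lambda>n. ?H X + ((\<Sum>k. ?H (R (2 * (k + n)))) + (\<Sum>k. ?H (R (2 * (k + n) + 1))))) \<longlonglongrightarrow> ?H X + (0 + 0)"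
      using tail[of 0] tail[of 1] by (intro tendsto_add tendsto_const) simp_all
    moreover have "?H (X \<inter> F) + ?H (X - F)
       \<le> ?H X + ((\<Sum>k. ?H (R (2 * (k + n)))) + (\<Sum>k. ?H (R (2 * (k + n) + 1))))" for n
    proof -
      have "?H (X \<inter> F) + ?H (X - F) \<le> ?H (X \<inter> F) + (?H (E (2 * n)) +
          ((\<Sum>k. ?H (R (2 * (k + n)))) + (\<Sum>k. ?H (R (2 * (k + n) + 1)))))"
        by (intro add_left_mono key)
      also have "\<dots> \<le> ?H X + ((\<Sum>k. ?H (R (2 * (k + n)))) + (\<Sum>k. ?H (R (2 * (k + n) + 1))))"
        unfolding add.assoc[symmetric] by (intro add_right_mono EF)
      finally show ?thesis .
    qed
    ultimately show ?thesis by (auto intro: LIMSEQ_le_const)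
  qed simp
  have "?H (X \<inter> F) + ?H (X - F) = ?H X" for X
  proof (cases "F = {}")
    case False
    have "?H X \<le> ?H (X \<inter> F) + ?H (X - F)"
      using hausdorff_outer_Un[of s "X \<inter> F" "X - F"] by (simp add: Int_Diff_Un)
    with le[OF False] show ?thesis by (intro antisym)
  qed (simp add: hausdorff_outer_empty)
  then show ?thesis
    by (auto simp: lambda_system_def Int_commute Diff_eq)
qed

lemma emeasure_hausdorff_measure:
  fixes S :: "'a::euclidean_space set"
  assumes "S \<in> sets borel"
  shows "emeasure (hausdorff_measure s) S = hausdorff_outer s S"
proof -
  let ?H = "hausdorff_outer s :: 'a set \<Rightarrow> ennreal"
  let ?L = "lambda_system UNIV UNIV ?H"
  interpret P: sigma_algebra UNIV "UNIV :: 'a set set"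
    using sigma_algebra_Pow[of "UNIV :: 'a set"] by simp
  have "outer_measure_space UNIV ?H"
    by (auto simp: outer_measure_space_def positive_def increasing_def countably_subadditive_def
        hausdorff_outer_empty hausdorff_outer_mono hausdorff_outer_subadditive)
  then have ms: "measure_space UNIV ?L ?H" by (rule P.caratheodory_lemma)
  then interpret L: sigma_algebra UNIV ?L by (simp add: measure_space_def)
  have sub: "sets borel \<subseteq> ?L"
    unfolding borel_eq_closed
    using L.sigma_sets_subset[of "Collect closed"] closed_in_lambda_system_hausdorff[of _ s]
    by (auto simp: sets_measure_of)
  have "measure_space UNIV (sets borel) ?H"
    using ms sub sets.sigma_algebra_axioms[of "borel :: 'a measure"]
    by (auto simp: measure_space_def positive_def countably_additive_def subset_eq)
  then show ?thesis
    unfolding hausdorff_measure_def using assms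
    by (subst emeasure_measure_of_sigma) (auto simp: measure_space_def)
qed

definition surface_measure :: "'a::euclidean_space measure" where
  "surface_measure = hausdorff_measure (DIM('a) - 1)"


section \<open>The Sobolev space and the elliptic form\<close>

definition test_function :: "'a::euclidean_space set \<Rightarrow> ('a \<Rightarrow> real) \<Rightarrow> bool" where
  "test_function D \<psi> \<longleftrightarrow> smooth_near UNIV \<psi> \<and>
     (\<exists>K. compact K \<and> K \<subseteq> D \<and> (\<forall>x. x \<notin> K \<longrightarrow> \<psi> x = 0))"

definition weak_derivative :: "'a::euclidean_space set \<Rightarrow> 'a \<Rightarrow> 'a l2 \<Rightarrow> 'a l2 \<Rightarrow> bool" where
  "weak_derivative D b u g \<longleftrightarrow> g \<in> L2 D \<and> (\<forall>\<psi>. test_function D \<psi> \<longrightarrow>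
     (LINT x:D|lborel. rep_l2 u x * frechet_derivative \<psi> (at x) b) =
     - (LINT x:D|lborel. rep_l2 g x * \<psi> x))"

definition H1 :: "'a::euclidean_space set \<Rightarrow> 'a l2 set" where
  "H1 D = {u \<in> L2 D. \<forall>b\<in>Basis. \<exists>g. weak_derivative D b u g}"

text \<open>A weak derivative is determined as an element of \<open>L\<^sub>2(D)\<close>, so for \<open>u \<in> H\<^sup>1(D)\<close> the choice
  below is unambiguous; similarly, a trace is determined up to a set of surface measure zero.\<close>

definition partial_deriv :: "'a::euclidean_space set \<Rightarrow> 'a \<Rightarrow> 'a l2 \<Rightarrow> 'a l2" where
  "partial_deriv D b u = (SOME g. weak_derivative D b u g)"

text \<open>\<open>g\<close> is (a representative of) the trace of \<open>u\<close>: the limit in \<open>L\<^sub>2(\<partial>D)\<close> of the restrictions to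
  \<open>\<partial>D\<close> of functions smooth up to the boundary that tend to \<open>u\<close> in \<open>H\<^sup>1(D)\<close>.\<close>

definition is_trace :: "'a::euclidean_space set \<Rightarrow> 'a l2 \<Rightarrow> ('a \<Rightarrow> real) \<Rightarrow> bool" where
  "is_trace D u g \<longleftrightarrow>
     g \<in> borel_measurable borel \<and>
     (\<integral>\<^sup>+x\<in>frontier D. ennreal ((g x)\<^sup>2) \<partial>surface_measure) < \<infinity> \<and>
     (\<exists>f :: nat \<Rightarrow> 'a \<Rightarrow> real.
        (\<forall>n. smooth_near (closure D) (f n)) \<and>
        (\<lambda>n. \<integral>\<^sup>+x\<in>D. ennreal ((f n x - rep_l2 u x)\<^sup>2) \<partial>lborel) \<longlonglongrightarrow> 0 \<and>
        (\<forall>b\<in>Basis. (\<lambda>n. \<integral>\<^sup>+x\<in>D. ennreal ((frechet_derivative (f n) (at x) b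
             - rep_l2 (partial_deriv D b u) x)\<^sup>2) \<partial>lborel) \<longlonglongrightarrow> 0) \<and>
        (\<lambda>n. \<integral>\<^sup>+x\<in>frontier D. ennreal ((f n x - g x)\<^sup>2) \<partial>surface_measure) \<longlonglongrightarrow> 0)"

definition trace_fun :: "'a::euclidean_space set \<Rightarrow> 'a l2 \<Rightarrow> 'a \<Rightarrow> real" where
  "trace_fun D u = (SOME g. is_trace D u g)"

definition elliptic_form ::
  "'a::euclidean_space set \<Rightarrow> ('a \<Rightarrow> real) \<Rightarrow> ('a \<Rightarrow> real) \<Rightarrow> ('a \<Rightarrow> real) \<Rightarrow> 'a l2 \<Rightarrow> 'a l2 \<Rightarrow> real" where
  "elliptic_form D k c \<mu> u v =
     (LINT x:D|lborel.
        k x * (\<Sum>b\<in>Basis. rep_l2 (partial_deriv D b u) x * rep_l2 (partial_deriv D b v) x)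
        + c x * rep_l2 u x * rep_l2 v x)
     + (LINT x:frontier D|surface_measure. \<mu> x * trace_fun D u x * trace_fun D v x)"

lemma elliptic_form_sym: "elliptic_form D k c \<mu> u v = elliptic_form D k c \<mu> v u"
  by (simp add: elliptic_form_def mult.commute mult.left_commute)

lemma smooth_near_continuous_on: "smooth_near S f \<Longrightarrow> continuous_on S f"
  unfolding smooth_near_def by (metis Ck_on.simps(1) continuous_on_subset)

lemma set_integrable_coeff:
  fixes D :: "'a::euclidean_space set"
  assumes "open D" "bounded D" "continuous_on (closure D) k" "square_integrable f" "square_integrable g"
  shows "set_integrable lborel D (\<lambda>x. k x * (f x * g x))"
proof -
  have "compact (k ` closure D)"
    using assms by (intro compact_continuous_image) (auto simp: compact_closure)
  then obtain B where B: "\<And>x. x \<in> closure D \<Longrightarrow> \<bar>k x\<bar> \<le> B"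
    by (metis (no_types, lifting) bounded_iff compact_imp_bounded imageI real_norm_def)
  have D: "D \<in> sets borel" using \<open>open D\<close> by simp
  have "continuous_on D k" using assms(3) closure_subset continuous_on_subset by blast
  then have m: "(\<lambda>x. indicator D x *\<^sub>R k x) \<in> borel_measurable lborel"
    using borel_measurable_continuous_on_indicator[of D k] D by simp
  show ?thesis
    unfolding set_integrable_def
  proof (rule Bochner_Integration.integrable_bound)
    show "integrable lborel (\<lambda>x. B * (f x * g x))"
      using square_integrable_prod[OF assms(4,5)] by simp
    have "(\<lambda>x. (indicator D x *\<^sub>R k x) * (f x * g x)) \<in> borel_measurable lborel"
      using m square_integrable_measurable[OF assms(4)] square_integrable_measurable[OF assms(5)]
      by (intro borel_measurable_times) auto
    then show "(\<lambda>x. indicator D x *\<^sub>R (k x * (f x * g x))) \<in> borel_measurable lborel"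
      by (simp add: mult.assoc)
    have "norm (indicator D x *\<^sub>R (k x * (f x * g x))) \<le> norm (B * (f x * g x))" for x
    proof (cases "x \<in> D")
      case True
      then have "\<bar>k x\<bar> \<le> \<bar>B\<bar>" using B[of x] closure_subset by fastforce
      then show ?thesis using True by (simp add: abs_mult mult_right_mono)
    qed simp
    then show "AE x in lborel. norm (indicator D x *\<^sub>R (k x * (f x * g x))) \<le> norm (B * (f x * g x))"
      by simp
  qed
qed

lemma elliptic_form_bounded_below:
  fixes D :: "'a::euclidean_space set"
  assumes D: "open D" "bounded D"
    and k: "smooth_near (closure D) k" "\<forall>x\<in>closure D. 0 \<le> k x"
    and c: "smooth_near (closure D) c"
    and \<mu>: "\<forall>x\<in>closure D. 0 \<le> \<mu> x"
  shows "\<exists>\<delta>. \<forall>u. \<delta> * (norm u)\<^sup>2 \<le> elliptic_form D k c \<mu> u u"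
proof -
  have "compact (c ` closure D)"
    using D by (intro compact_continuous_image smooth_near_continuous_on[OF c]) (auto simp: compact_closure)
  then obtain B where B: "\<And>x. x \<in> closure D \<Longrightarrow> \<bar>c x\<bar> \<le> B"
    by (metis (no_types, lifting) bounded_iff compact_imp_bounded imageI real_norm_def)
  have "- \<bar>B\<bar> * (norm u)\<^sup>2 \<le> elliptic_form D k c \<mu> u u" for u
  proof -
    let ?u = "rep_l2 u" and ?p = "\<lambda>b. rep_l2 (partial_deriv D b u)"
    have uu: "integrable lborel (\<lambda>x. ?u x * ?u x)"
      by (intro square_integrable_prod square_integrable_rep_l2)
    have uD: "set_integrable lborel D (\<lambda>x. ?u x * ?u x)"
      using uu integrable_mult_indicator[of D lborel "\<lambda>x. ?u x * ?u x"] D unfolding set_integrable_def by simp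
    have "set_integrable lborel D (\<lambda>x. \<Sum>b\<in>Basis. k x * (?p b x * ?p b x))"
      unfolding set_integrable_def scaleR_sum_right
      by (intro Bochner_Integration.integrable_sum set_integrable_coeff[unfolded set_integrable_def] D
          smooth_near_continuous_on k(1) square_integrable_rep_l2)
    moreover have "set_integrable lborel D (\<lambda>x. c x * (?u x * ?u x))"
      by (intro set_integrable_coeff D smooth_near_continuous_on c square_integrable_rep_l2)
    ultimately have F: "set_integrable lborel D (\<lambda>x. k x * (\<Sum>b\<in>Basis. ?p b x * ?p b x) + c x * ?u x * ?u x)"
      unfolding sum_distrib_left mult.assoc[of "c _"] by (rule set_integral_add)
    have "(LINT x:D|lborel. ?u x * ?u x) \<le> (LINT x|lborel. ?u x * ?u x)"
      unfolding set_lebesgue_integral_def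
      using uD uu by (intro integral_mono) (auto simp: set_integrable_def indicator_def)
    then have "- \<bar>B\<bar> * (norm u)\<^sup>2 \<le> - \<bar>B\<bar> * (LINT x:D|lborel. ?u x * ?u x)"
      unfolding power2_norm_eq_inner inner_l2_rep by (intro mult_left_mono_neg) auto
    also have "\<dots> = (LINT x:D|lborel. - \<bar>B\<bar> * (?u x * ?u x))"
      by (rule set_integral_mult_right[symmetric])
    also have "\<dots> \<le> (LINT x:D|lborel. k x * (\<Sum>b\<in>Basis. ?p b x * ?p b x) + c x * ?u x * ?u x)"
    proof (rule set_integral_mono)
      show "set_integrable lborel D (\<lambda>x. - \<bar>B\<bar> * (?u x * ?u x))"
        using uD by (intro set_integrable_mult_right) auto
      fix x assume "x \<in> D"
      then have x: "x \<in> closure D" using closure_subset by blast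
      have "- \<bar>B\<bar> * (?u x * ?u x) \<le> c x * (?u x * ?u x)"
        using B[OF x] by (intro mult_right_mono) auto
      moreover have "0 \<le> k x * (\<Sum>b\<in>Basis. ?p b x * ?p b x)"
        using k(2) x by (simp add: sum_nonneg)
      ultimately show "- \<bar>B\<bar> * (?u x * ?u x) \<le> k x * (\<Sum>b\<in>Basis. ?p b x * ?p b x) + c x * ?u x * ?u x"
        unfolding mult.assoc by linarith
    qed (rule F)
    finally have 1: "- \<bar>B\<bar> * (norm u)\<^sup>2 \<le> (LINT x:D|lborel. k x * (\<Sum>b\<in>Basis. ?p b x * ?p b x) + c x * ?u x * ?u x)" .
    have "0 \<le> (LINT x:frontier D|surface_measure. \<mu> x * trace_fun D u x * trace_fun D u x)"
      unfolding set_lebesgue_integral_def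
    proof (rule Bochner_Integration.integral_nonneg)
      fix x
      show "0 \<le> indicator (frontier D) x *\<^sub>R (\<mu> x * trace_fun D u x * trace_fun D u x)"
      proof (cases "x \<in> frontier D")
        case True
        then have "0 \<le> \<mu> x" using \<mu> by (auto simp: frontier_def)
        then show ?thesis by (simp add: mult.assoc)
      qed simp
    qed
    with 1 show ?thesis unfolding elliptic_form_def by linarith
  qed
  then show ?thesis by blast
qed


section \<open>The discrete elliptic operator\<close>

definition discrete_elliptic_operator ::
  "'v::real_inner set \<Rightarrow> ('v \<Rightarrow> 'v \<Rightarrow> real) \<Rightarrow> ('v \<Rightarrow> 'v) \<Rightarrow> bool" where
  "discrete_elliptic_operator V a A \<longleftrightarrow> A ` V \<subseteq> V \<and> (\<forall>y\<in>V. \<forall>v\<in>V. inner (A y) v = a y v)"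

definition eigenpair_on :: "'v::real_vector set \<Rightarrow> ('v \<Rightarrow> 'v) \<Rightarrow> real \<Rightarrow> 'v \<Rightarrow> bool" where
  "eigenpair_on V A lam v \<longleftrightarrow> v \<in> V \<and> v \<noteq> 0 \<and> A v = lam *\<^sub>R v"

definition smallest_eigenvalue_on :: "'v::real_vector set \<Rightarrow> ('v \<Rightarrow> 'v) \<Rightarrow> real \<Rightarrow> bool" where
  "smallest_eigenvalue_on V A lam \<longleftrightarrow>
     (\<exists>v. eigenpair_on V A lam v) \<and> (\<forall>lam'. (\<exists>v. eigenpair_on V A lam' v) \<longrightarrow> lam \<le> lam')"


section \<open>Pade approximation of \<open>exp (- z)\<close>\<close>

definition pade_num :: "nat \<Rightarrow> nat \<Rightarrow> real poly" where
  "pade_num l m = smult (fact l / fact (l + m))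
     (\<Sum>k\<le>l. monom (fact (l + m - k) / (fact k * fact (l - k)) * (- 1) ^ k) k)"

definition pade_den :: "nat \<Rightarrow> nat \<Rightarrow> real poly" where
  "pade_den l m = smult (fact m / fact (l + m))
     (\<Sum>k\<le>m. monom (fact (l + m - k) / (fact k * fact (m - k))) k)"

definition poly_op :: "real poly \<Rightarrow> ('v::real_vector \<Rightarrow> 'v) \<Rightarrow> 'v \<Rightarrow> 'v" where
  "poly_op p B v = (\<Sum>k\<le>degree p. coeff p k *\<^sub>R (B ^^ k) v)"

text \<open>\<open>Q\<^sub>l\<^sub>m(B)\<^sup>-\<^sup>1 P\<^sub>l\<^sub>m(B)\<close> as an operator on \<open>V\<close>.\<close>

definition pade_op :: "'v::real_vector set \<Rightarrow> nat \<Rightarrow> nat \<Rightarrow> ('v \<Rightarrow> 'v) \<Rightarrow> 'v \<Rightarrow> 'v" where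
  "pade_op V l m B v = the_inv_into V (poly_op (pade_den l m) B) (poly_op (pade_num l m) B v)"


section \<open>Fundamental mode exact schemes\<close>

definition fundamental_mode_exact ::
  "'v::real_inner \<Rightarrow> real \<Rightarrow> real \<Rightarrow> nat \<Rightarrow> (nat \<Rightarrow> 'v) \<Rightarrow> bool" where
  "fundamental_mode_exact \<phi>\<^sub>1 lam1 \<tau> N y \<longleftrightarrow>
     (\<forall>n<N. inner (y (Suc n)) \<phi>\<^sub>1 = exp (- lam1 * \<tau>) * inner (y n) \<phi>\<^sub>1)"

end

theory Submission
  imports Defs
begin

text \<open>
  Why the scheme is exact on the fundamental mode.  The operator \<open>A\<close> is self-adjoint on \<open>V\<close>, and
  \<open>B = \<tau> (A - \<lambda>\<^sub>1 I)\<close> annihilates \<open>\<phi>\<^sub>1\<close>.  If \<open>u = Q(B)\<^sup>-\<^sup>1 P(B) y\<close>, pairing \<open>Q(B) u = P(B) y\<close> with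
  \<open>\<phi>\<^sub>1\<close> and moving the operators over to \<open>\<phi>\<^sub>1\<close> leaves \<open>Q(0) (u, \<phi>\<^sub>1) = P(0) (y, \<phi>\<^sub>1)\<close>, and both
  polynomials are \<open>1\<close> at the origin (\<open>poly_pade_num_0\<close>, \<open>coeff_pade_den_0\<close>).  So \<open>R(B)\<close> preserves
  the first coefficient (\<open>pade_op_kernel_component\<close>), and \<open>S\<close> multiplies it by
  \<open>exp (- \<lambda>\<^sub>1 \<tau>)\<close>.

  What remains is that \<open>Q(B)\<close> is invertible on \<open>V\<close>; this is where the minimality of \<open>\<lambda>\<^sub>1\<close> enters.
  The Rayleigh quotient of a self-adjoint operator on a finite-dimensional space attains its
  minimum, at an eigenvector, so \<open>(A v, v) \<ge> \<lambda>\<^sub>1 (v, v)\<close> (\<open>Rayleigh_lower_bound\<close>) and \<open>B\<close> is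
  nonnegative.  As the coefficients of \<open>Q\<close> are nonnegative with \<open>Q(0) = 1\<close>, this gives
  \<open>(Q(B) v, v) \<ge> (v, v)\<close>, so \<open>Q(B)\<close> is injective, hence bijective (\<open>poly_op_bij\<close>).

  The linearity of \<open>A\<close> on \<open>V\<close> comes from symmetry: \<open>(A v, w) = (v, A w)\<close> is linear in \<open>v\<close> for
  every \<open>w \<in> V\<close>.  This spares a study of the linearity of weak derivatives and traces, on which
  the elliptic form is built.  Expanding \<open>A v\<close> by scalar products against vectors of \<open>V\<close> also makes
  \<open>A\<close> continuous (\<open>bounded_linear_extension\<close>), as the minimization needs.
\<close>

section \<open>Expansions and compactness in finite-dimensional subspaces\<close>

text \<open>An orthogonal basis provides such an expansion with \<open>d b = b / (b, b)\<close>.  Coefficients that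
  are scalar products against vectors of \<open>V\<close> let a self-adjoint operator be moved onto these
  vectors.\<close>

lemma finite_dim_expansion:
  fixes V :: "'v::real_inner set"
  assumes "subspace V" "\<exists>B. finite B \<and> V \<subseteq> span B"
  obtains C d where "finite C" "C \<subseteq> V" "\<forall>b\<in>C. d b \<in> V"
    "\<forall>v\<in>V. v = (\<Sum>b\<in>C. inner v (d b) *\<^sub>R b)"
proof -
  obtain B where B: "finite B" "V \<subseteq> span B" using assms(2) by blast
  obtain B' where B': "B' \<subseteq> V" "independent B'" "V \<subseteq> span B'"
    using maximal_independent_subset by blast
  have "finite B'"
    using independent_span_bound[OF B(1) B'(2)] B'(1) B(2) by blast
  then obtain C where C: "finite C" "span C = span B'" "pairwise orthogonal C"
    using basis_orthogonal by blast
  have V: "span C = V"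
    using C(2) B' assms(1) by (metis span_minimal subset_antisym)
  then have CV: "C \<subseteq> V" using span_superset by blast
  define d where "d = (\<lambda>b::'v. (1 / inner b b) *\<^sub>R b)"
  have "v = (\<Sum>b\<in>C. inner v (d b) *\<^sub>R b)" if "v \<in> V" for v
  proof -
    from that V obtain u where u: "v = (\<Sum>b\<in>C. u b *\<^sub>R b)"
      using span_finite[OF C(1)] by auto
    have "inner v (d b) *\<^sub>R b = u b *\<^sub>R b" if b: "b \<in> C" for b
    proof -
      have "inner v b = (\<Sum>b'\<in>C. if b' = b then u b * inner b b else 0)"
        unfolding u inner_sum_left
        using C(3) b by (intro sum.cong) (auto simp: pairwise_def orthogonal_def)
      then have "inner v b = u b * inner b b" using C(1) b by simp
      then show ?thesis by (cases "b = 0") (auto simp: d_def)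
    qed
    then have "(\<Sum>b\<in>C. inner v (d b) *\<^sub>R b) = (\<Sum>b\<in>C. u b *\<^sub>R b)"
      by (rule sum.cong[OF refl])
    then show ?thesis using u by simp
  qed
  moreover have "d b \<in> V" if "b \<in> C" for b
    using that CV assms(1) by (auto simp: d_def subspace_scale)
  ultimately show thesis using that C(1) CV by blast
qed

lemma compact_coefficient_box:
  fixes C :: "'v::real_normed_vector set"
  assumes "finite C"
  shows "compact {(\<Sum>b\<in>C. x b *\<^sub>R b) | x. \<forall>b\<in>C. \<bar>x b\<bar> \<le> r b}"
  using assms
proof (induction C)
  case empty
  then show ?case by simp
next
  case (insert c C)
  let ?K = "{(\<Sum>b\<in>C. x b *\<^sub>R b) | x. \<forall>b\<in>C. \<bar>x b\<bar> \<le> r b}"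
  have "compact ((\<lambda>t. t *\<^sub>R c) ` {- r c .. r c})"
    by (intro compact_continuous_image continuous_intros compact_Icc)
  then have "compact {p + q | p q. p \<in> (\<lambda>t. t *\<^sub>R c) ` {- r c .. r c} \<and> q \<in> ?K}"
    using insert.IH by (rule compact_sums)
  moreover have "{p + q | p q. p \<in> (\<lambda>t. t *\<^sub>R c) ` {- r c .. r c} \<and> q \<in> ?K}
      = {(\<Sum>b\<in>insert c C. x b *\<^sub>R b) | x. \<forall>b\<in>insert c C. \<bar>x b\<bar> \<le> r b}" (is "?L = ?R")
  proof
    show "?L \<subseteq> ?R"
    proof
      fix z assume "z \<in> ?L"
      then obtain t x where z: "z = t *\<^sub>R c + (\<Sum>b\<in>C. x b *\<^sub>R b)"
        and b: "t \<in> {- r c .. r c}" "\<forall>b\<in>C. \<bar>x b\<bar> \<le> r b" by blast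
      have "(\<Sum>b\<in>C. (x(c := t)) b *\<^sub>R b) = (\<Sum>b\<in>C. x b *\<^sub>R b)"
        using insert.hyps by (intro sum.cong) auto
      then have "z = (\<Sum>b\<in>insert c C. (x(c := t)) b *\<^sub>R b)"
        using insert.hyps z by simp
      moreover have "\<forall>b\<in>insert c C. \<bar>(x(c := t)) b\<bar> \<le> r b" using b by auto
      ultimately show "z \<in> ?R" by blast
    qed
    show "?R \<subseteq> ?L"
    proof
      fix z assume "z \<in> ?R"
      then obtain x where z: "z = (\<Sum>b\<in>insert c C. x b *\<^sub>R b)"
        and b: "\<forall>b\<in>insert c C. \<bar>x b\<bar> \<le> r b" by blast
      have "z = x c *\<^sub>R c + (\<Sum>b\<in>C. x b *\<^sub>R b)" using z insert.hyps by simp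
      moreover have "x c \<in> {- r c .. r c}" using b by auto
      ultimately show "z \<in> ?L" using b by blast
    qed
  qed
  ultimately show ?case by simp
qed

text \<open>The coefficients of unit vectors are bounded by Cauchy--Schwarz, so the unit sphere of \<open>V\<close>
  is a closed part of a compact box.\<close>

lemma compact_unit_sphere_subspace:
  fixes V :: "'v::real_inner set"
  assumes "subspace V" "\<exists>B. finite B \<and> V \<subseteq> span B"
  shows "compact (V \<inter> sphere 0 1)"
proof -
  obtain C d where C: "finite C" "C \<subseteq> V" and ex: "\<forall>v\<in>V. v = (\<Sum>b\<in>C. inner v (d b) *\<^sub>R b)"
    by (rule finite_dim_expansion[OF assms]) (rule that)
  let ?K = "{(\<Sum>b\<in>C. x b *\<^sub>R b) | x. \<forall>b\<in>C. \<bar>x b\<bar> \<le> norm (d b)}"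
  have "?K \<subseteq> V"
    using C(2) assms(1) by (auto intro!: subspace_sum subspace_scale)
  moreover have "V \<inter> sphere 0 1 \<subseteq> ?K"
  proof
    fix v assume v: "v \<in> V \<inter> sphere 0 1"
    then have "\<bar>inner v (d b)\<bar> \<le> norm (d b)" for b
      using Cauchy_Schwarz_ineq2[of v "d b"] by simp
    moreover have "v = (\<Sum>b\<in>C. inner v (d b) *\<^sub>R b)" using ex v by blast
    ultimately show "v \<in> ?K"
      by (intro CollectI exI[of _ "\<lambda>b. inner v (d b)"]) blast
  qed
  ultimately have "V \<inter> sphere 0 1 = ?K \<inter> sphere 0 1" by blast
  moreover have "compact (?K \<inter> sphere 0 1)"
    unfolding sphere_def dist_0_norm
    by (intro compact_Int_closed compact_coefficient_box C(1) closed_Collect_eq continuous_intros)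
  ultimately show ?thesis by simp
qed

section \<open>Self-adjoint operators on finite-dimensional subspaces\<close>

text \<open>Linearity on \<open>V\<close> follows from \<open>sym\<close>: the vector \<open>A v\<close> of \<open>V\<close> is determined by its scalar
  products \<open>(A v, w) = (v, A w)\<close>, and these are linear in \<open>v\<close>.\<close>

locale self_adjoint_on =
  fixes V :: "'v::real_inner set" and A :: "'v \<Rightarrow> 'v"
  assumes subspace: "subspace V"
    and finite_dim: "\<exists>B. finite B \<and> V \<subseteq> span B"
    and maps: "v \<in> V \<Longrightarrow> A v \<in> V"
    and sym: "v \<in> V \<Longrightarrow> w \<in> V \<Longrightarrow> inner (A v) w = inner v (A w)"
begin

text \<open>Expanding \<open>A v\<close> and moving \<open>A\<close> to the other side of the scalar product gives
  \<open>A v = \<Sum>\<^sub>b (v, A (d b)) b\<close>, a formula that is linear and continuous in \<open>v\<close> on the whole space.\<close>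

lemma bounded_linear_extension:
  obtains F where "bounded_linear F" "\<forall>v\<in>V. F v = A v"
proof -
  obtain C d where "finite C" "C \<subseteq> V" and C: "\<forall>b\<in>C. d b \<in> V"
    and ex: "\<forall>v\<in>V. v = (\<Sum>b\<in>C. inner v (d b) *\<^sub>R b)"
    by (rule finite_dim_expansion[OF subspace finite_dim]) (rule that)
  show thesis
  proof
    show "bounded_linear (\<lambda>v. \<Sum>b\<in>C. inner v (A (d b)) *\<^sub>R b)"
      by (intro bounded_linear_sum bounded_linear_scaleR_const bounded_linear_inner_left)
    have "(\<Sum>b\<in>C. inner v (A (d b)) *\<^sub>R b) = A v" if v: "v \<in> V" for v
    proof -
      have "A v = (\<Sum>b\<in>C. inner (A v) (d b) *\<^sub>R b)" using ex maps[OF v] by blast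
      also have "\<dots> = (\<Sum>b\<in>C. inner v (A (d b)) *\<^sub>R b)"
        using C by (intro sum.cong) (simp_all add: sym[OF v])
      finally show ?thesis by simp
    qed
    then show "\<forall>v\<in>V. (\<Sum>b\<in>C. inner v (A (d b)) *\<^sub>R b) = A v" by blast
  qed
qed

lemma scale:
  assumes "v \<in> V"
  shows "A (r *\<^sub>R v) = r *\<^sub>R A v"
proof -
  obtain F where "bounded_linear F" and F: "\<forall>v\<in>V. F v = A v"
    by (rule bounded_linear_extension) (rule that)
  then have "F (r *\<^sub>R v) = r *\<^sub>R F v"
    by (simp add: bounded_linear.linear linear_cmul)
  then show ?thesis using F assms subspace by (simp add: subspace_scale)
qed

text \<open>At a minimizer \<open>v\<close> of the Rayleigh quotient the nonnegative form \<open>(A w, w) - r (w, w)\<close>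
  vanishes; by first-order optimality in the direction \<open>e = A v - r v\<close>, this residual is zero.\<close>

lemma Rayleigh_minimizer:
  assumes "w \<in> V" "w \<noteq> 0"
  obtains r v where "eigenpair_on V A r v" "\<And>u. u \<in> V \<Longrightarrow> r * inner u u \<le> inner (A u) u"
proof -
  obtain F where F: "bounded_linear F" and FA: "\<forall>v\<in>V. F v = A v"
    by (rule bounded_linear_extension) (rule that)
  let ?S = "V \<inter> sphere 0 1"
  have unit: "(1 / norm u) *\<^sub>R u \<in> ?S" if "u \<in> V" "u \<noteq> 0" for u
    using that subspace by (simp add: subspace_scale)
  have "continuous_on ?S (\<lambda>v. inner (F v) v)"
    by (intro continuous_intros bounded_linear.continuous_on[OF F])
  then obtain v where v: "v \<in> ?S" and min: "\<And>u. u \<in> ?S \<Longrightarrow> inner (F v) v \<le> inner (F u) u"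
    using continuous_attains_inf[OF compact_unit_sphere_subspace[OF subspace finite_dim]]
      unit[OF assms] by blast
  define r where "r = inner (F v) v"
  have vV: "v \<in> V" and vv: "inner v v = 1" using v by (auto simp: norm_eq_1)
  have ge: "r * inner u u \<le> inner (F u) u" if u: "u \<in> V" for u
  proof (cases "u = 0")
    case False
    have "r \<le> inner (F ((1 / norm u) *\<^sub>R u)) ((1 / norm u) *\<^sub>R u)"
      unfolding r_def by (rule min[OF unit[OF u False]])
    also have "\<dots> = inner (F u) u / (norm u)\<^sup>2"
      by (simp add: linear_cmul[OF bounded_linear.linear[OF F]] power2_eq_square)
    finally show ?thesis
      using False by (simp add: field_simps power2_norm_eq_inner[symmetric])
  qed (simp add: linear_0[OF bounded_linear.linear[OF F]])
  define e where "e = F v - r *\<^sub>R v"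
  have eV: "e \<in> V"
    using vV FA maps subspace by (simp add: e_def subspace_diff subspace_scale)
  define q where "q = inner (F e) e - r * inner e e"
  have q: "0 \<le> q" using ge[OF eV] by (simp add: q_def)
  have quad: "0 \<le> 2 * t * inner e e + t\<^sup>2 * q" for t
  proof -
    have "v + t *\<^sub>R e \<in> V" using vV eV subspace by (simp add: subspace_add subspace_scale)
    then have "r * inner (v + t *\<^sub>R e) (v + t *\<^sub>R e) \<le> inner (F (v + t *\<^sub>R e)) (v + t *\<^sub>R e)"
      by (rule ge)
    moreover have "inner (v + t *\<^sub>R e) (v + t *\<^sub>R e) = 1 + 2 * t * inner v e + t\<^sup>2 * inner e e"
      using vv by (simp add: inner_add_left inner_add_right inner_commute[of e v] power2_eq_square algebra_simps)
    moreover have "inner (F (v + t *\<^sub>R e)) (v + t *\<^sub>R e) = r + 2 * t * inner (F v) e + t\<^sup>2 * inner (F e) e"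
    proof -
      have "inner (F e) v = inner (F v) e"
        using sym[OF eV vV] FA eV vV by (simp add: inner_commute)
      moreover have "F (v + t *\<^sub>R e) = F v + t *\<^sub>R F e"
        using bounded_linear.linear[OF F] by (simp add: linear_add linear_cmul)
      ultimately show ?thesis
        by (simp add: inner_add_left inner_add_right r_def power2_eq_square algebra_simps)
    qed
    moreover have "2 * t * inner e e = 2 * t * inner (F v) e - r * (2 * t * inner v e)"
      unfolding inner_diff_left[of "F v" "r *\<^sub>R v" e, folded e_def] by (simp add: algebra_simps)
    ultimately show ?thesis
      unfolding q_def by (simp add: distrib_left right_diff_distrib mult.left_commute[of r])
  qed
  have "inner e e = 0"
  proof (rule ccontr)
    assume "inner e e \<noteq> 0"
    then have p: "inner e e > 0" by simp
    (* For q > 0 the quadratic is negative at its minimizer - (e, e) / q; with the denominator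
       q + 1 the argument covers q = 0 as well. *)
    define s where "s = inner e e / (q + 1)"
    have "s * (q + 1) = inner e e" using q by (simp add: s_def)
    then have s: "s * q + s = inner e e" by (simp add: distrib_left)
    have "s > 0" using p q by (simp add: s_def)
    have "0 \<le> s * (s * q - 2 * inner e e)"
      using quad[of "- s"] by (simp add: power2_eq_square algebra_simps)
    then have "2 * inner e e \<le> s * q" using \<open>s > 0\<close> by (simp add: zero_le_mult_iff)
    then show False using p s \<open>s > 0\<close> by linarith
  qed
  then have "A v = r *\<^sub>R v" using FA vV by (simp add: e_def)
  then have "eigenpair_on V A r v" using vV vv by (auto simp: eigenpair_on_def)
  then show thesis using that ge FA by simp
qed

lemma Rayleigh_lower_bound:
  assumes "smallest_eigenvalue_on V A lam" "v \<in> V"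
  shows "lam * inner v v \<le> inner (A v) v"
proof (cases "v = 0")
  case False
  obtain r w where "eigenpair_on V A r w" and r: "r * inner v v \<le> inner (A v) v"
    using Rayleigh_minimizer[OF assms(2) False] assms(2) by metis
  then have "lam \<le> r" using assms(1) by (auto simp: smallest_eigenvalue_on_def)
  then show ?thesis using r mult_right_mono[of lam r "inner v v"] by simp
qed simp

lemma injective_imp_bij:
  assumes "\<And>v. v \<in> V \<Longrightarrow> A v = 0 \<Longrightarrow> v = 0"
  shows "bij_betw A V V"
proof -
  obtain F where F: "linear F" and FA: "\<forall>v\<in>V. F v = A v"
    by (rule bounded_linear_extension) (blast intro: that bounded_linear.linear)
  obtain B where B: "B \<subseteq> V" "independent B" "V \<subseteq> span B"
    using maximal_independent_subset by blast
  have "span B = V" using B subspace by (metis span_minimal subset_antisym)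
  have finB: "finite B"
    using finite_dim independent_span_bound[OF _ B(2)] B(1) by blast
  have inj: "inj_on F V"
    using assms FA by (subst linear_injective_on_subspace_0[OF F subspace]) auto
  have ind: "independent (F ` B)"
    using linear_independent_injective_image[OF F B(2)] inj \<open>span B = V\<close> by simp
  have FV: "F v \<in> V" if "v \<in> V" for v using FA maps that by simp
  have "V \<subseteq> span (F ` B)"
  proof
    fix v assume v: "v \<in> V"
    (* Otherwise v together with F ` B would be independent and larger than the basis B. *)
    show "v \<in> span (F ` B)"
    proof (rule ccontr)
      assume n: "v \<notin> span (F ` B)"
      then have "v \<notin> F ` B" using span_base[of v "F ` B"] by argo
      have "F ` B \<subseteq> V" using FV B(1) by blast
      then have "insert v (F ` B) \<subseteq> span B" using v \<open>span B = V\<close> by simp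
      then have "card (insert v (F ` B)) \<le> card B"
        using independent_span_bound[OF finB independent_insertI[OF n ind]] by simp
      moreover have "card (F ` B) = card B"
        using inj B(1) by (metis card_image inj_on_subset)
      ultimately show False using \<open>v \<notin> F ` B\<close> finB by simp
    qed
  qed
  then have "V \<subseteq> F ` V"
    using linear_span_image[OF F, of B] \<open>span B = V\<close> by simp
  then have "F ` V = V" using FV by blast
  then have "bij_betw F V V" using inj by (simp add: bij_betw_def)
  then show ?thesis using bij_betw_cong[of V F A V] FA by simp
qed

lemma funpow_maps: "v \<in> V \<Longrightarrow> (A ^^ k) v \<in> V"
  by (induction k) (auto intro: maps)

lemma funpow_sym: "v \<in> V \<Longrightarrow> w \<in> V \<Longrightarrow> inner ((A ^^ k) v) w = inner v ((A ^^ k) w)"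
proof (induction k arbitrary: w)
  case (Suc k)
  then have "inner ((A ^^ Suc k) v) w = inner v ((A ^^ k) (A w))"
    by (simp add: sym funpow_maps maps)
  then show ?case by (simp add: funpow_swap1)
qed simp

lemma poly_op_self_adjoint: "self_adjoint_on V (poly_op p A)"
proof
  fix v w assume v: "v \<in> V"
  show "poly_op p A v \<in> V"
    unfolding poly_op_def using subspace v
    by (intro subspace_sum subspace_scale funpow_maps) auto
  assume w: "w \<in> V"
  show "inner (poly_op p A v) w = inner v (poly_op p A w)"
    unfolding poly_op_def inner_sum_left inner_sum_right using v w by (simp add: funpow_sym)
qed (fact subspace finite_dim)+

lemma poly_op_eigenvector:
  assumes "v \<in> V" "A v = lam *\<^sub>R v"
  shows "poly_op p A v = poly p lam *\<^sub>R v"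
proof -
  have "(A ^^ k) v = lam ^ k *\<^sub>R v" for k
    using assms by (induction k) (simp_all add: scale mult.commute)
  then show ?thesis
    by (simp add: poly_op_def poly_altdef scaleR_sum_left)
qed

text \<open>Split an even power evenly between the two arguments; an odd power leaves one factor \<open>A\<close>,
  which is nonnegative.\<close>

lemma funpow_nonneg:
  assumes "\<And>u. u \<in> V \<Longrightarrow> 0 \<le> inner (A u) u" "v \<in> V"
  shows "0 \<le> inner ((A ^^ k) v) v"
proof (cases "even k")
  case True
  then obtain j where k: "k = j + j" by (auto simp: mult_2 elim!: evenE)
  have "inner ((A ^^ k) v) v = inner ((A ^^ j) v) ((A ^^ j) v)"
    unfolding k funpow_add o_def using assms(2) by (simp add: funpow_sym funpow_maps)
  then show ?thesis by simp
next
  case False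
  then obtain j where k: "k = j + Suc j" by (auto simp: mult_2 elim!: oddE)
  have "inner ((A ^^ k) v) v = inner (A ((A ^^ j) v)) ((A ^^ j) v)"
    unfolding k funpow_add o_def using funpow_sym[OF funpow_maps[OF assms(2), of "Suc j"] assms(2), of j]
    by simp
  then show ?thesis using assms funpow_maps by simp
qed

text \<open>Every term of \<open>(p(A) v, v)\<close> is nonnegative, and the constant one is already positive for
  \<open>v \<noteq> 0\<close>, so \<open>p(A)\<close> has trivial kernel on \<open>V\<close>.\<close>

lemma poly_op_bij:
  assumes "\<And>u. u \<in> V \<Longrightarrow> 0 \<le> inner (A u) u"
    and "\<And>i. 0 \<le> coeff p i" "0 < coeff p 0"
  shows "bij_betw (poly_op p A) V V"
proof (rule self_adjoint_on.injective_imp_bij[OF poly_op_self_adjoint])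
  fix v assume v: "v \<in> V" and z: "poly_op p A v = 0"
  have "coeff p 0 * inner v v = (\<Sum>i\<in>{0}. coeff p i * inner ((A ^^ i) v) v)" by simp
  also have "\<dots> \<le> (\<Sum>i\<le>degree p. coeff p i * inner ((A ^^ i) v) v)"
    using assms v by (intro sum_mono2) (auto intro!: mult_nonneg_nonneg funpow_nonneg)
  also have "\<dots> = inner (poly_op p A v) v"
    by (simp add: poly_op_def inner_sum_left)
  finally have "coeff p 0 * inner v v \<le> 0" using z by simp
  then have "inner v v \<le> 0" using assms(3) by (simp add: mult_le_0_iff)
  then have "inner v v = 0" using inner_ge_zero[of v] by (rule order_antisym)
  then show "v = 0" by simp
qed

end

lemma discrete_elliptic_operator_self_adjoint:
  assumes "subspace V" "\<exists>B. finite B \<and> V \<subseteq> span B"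
    and A: "discrete_elliptic_operator V a A" and "\<And>u v. a u v = a v u"
  shows "self_adjoint_on V A"
proof
  fix v w assume v: "v \<in> V"
  show "A v \<in> V" using A v by (auto simp: discrete_elliptic_operator_def)
  assume w: "w \<in> V"
  show "inner (A v) w = inner v (A w)"
    using A v w assms(4)[of v w] by (auto simp: discrete_elliptic_operator_def inner_commute[of v])
qed fact+

section \<open>Pade approximants of self-adjoint operators\<close>

lemma poly_pade_num_0: "poly (pade_num l m) 0 = 1"
  by (simp add: pade_num_def poly_0_coeff_0 coeff_sum)

lemma coeff_pade_den_0: "coeff (pade_den l m) 0 = 1"
  by (simp add: pade_den_def coeff_sum)

lemma coeff_pade_den_nonneg: "0 \<le> coeff (pade_den l m) i"
  by (auto simp: pade_den_def coeff_sum intro!: mult_nonneg_nonneg sum_nonneg)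

text \<open>A kernel vector \<open>\<phi>\<close> is fixed by \<open>P(A)\<close> and by \<open>Q(A)\<close>, and both are self-adjoint, so they can be
  dropped from \<open>(Q(A) u, \<phi>) = (P(A) v, \<phi>)\<close>.\<close>

lemma (in self_adjoint_on) pade_op_kernel_component:
  assumes nonneg: "\<And>u. u \<in> V \<Longrightarrow> 0 \<le> inner (A u) u"
    and phi: "\<phi> \<in> V" "A \<phi> = 0" and v: "v \<in> V"
  shows "pade_op V l m A v \<in> V" "inner (pade_op V l m A v) \<phi> = inner v \<phi>"
proof -
  let ?P = "poly_op (pade_num l m) A" and ?Q = "poly_op (pade_den l m) A"
  interpret P: self_adjoint_on V ?P by (rule poly_op_self_adjoint)
  interpret Q: self_adjoint_on V ?Q by (rule poly_op_self_adjoint)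
  have bij: "bij_betw ?Q V V"
    using nonneg by (intro poly_op_bij) (auto simp: coeff_pade_den_nonneg coeff_pade_den_0)
  define u where "u = pade_op V l m A v"
  show uV: "pade_op V l m A v \<in> V"
    unfolding pade_op_def using bij P.maps[OF v]
    by (metis bij_betwE bij_betw_the_inv_into)
  have Qu: "?Q u = ?P v"
    unfolding u_def pade_op_def using bij P.maps[OF v] by (rule f_the_inv_into_f_bij_betw)
  have P\<phi>: "?P \<phi> = \<phi>" and Q\<phi>: "?Q \<phi> = \<phi>"
    using poly_op_eigenvector[of \<phi> 0] phi
    by (simp_all add: poly_pade_num_0 poly_0_coeff_0[of "pade_den l m"] coeff_pade_den_0)
  have "inner u \<phi> = inner (?Q u) \<phi>"
    using Q.sym[of u \<phi>] uV phi Q\<phi> by (simp add: u_def)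
  also have "\<dots> = inner v \<phi>"
    unfolding Qu using P.sym[OF v phi(1)] P\<phi> by simp
  finally show "inner (pade_op V l m A v) \<phi> = inner v \<phi>" by (simp add: u_def)
qed

section \<open>Exactness on the fundamental mode\<close>

theorem theorem2:
  fixes \<Omega> :: "(real ^ 'd) set"
    and k c \<mu> :: "real ^ 'd \<Rightarrow> real"
    and V :: "(real ^ 'd) l2 set"
    and A A' S :: "(real ^ 'd) l2 \<Rightarrow> (real ^ 'd) l2"
    and \<phi>\<^sub>1 w\<^sub>0 :: "(real ^ 'd) l2"
    and y :: "nat \<Rightarrow> (real ^ 'd) l2"
    and \<kappa> lam1 \<tau> T :: real
    and N l m :: nat
  assumes "CARD('d) = 2 \<or> CARD('d) = 3"
    and "open \<Omega>" "connected \<Omega>" "\<Omega> \<noteq> {}" "bounded \<Omega>" "piecewise_smooth_boundary \<Omega>"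
    and "smooth_near (closure \<Omega>) k" "smooth_near (closure \<Omega>) c" "smooth_near (closure \<Omega>) \<mu>"
    and "\<kappa> > 0" "\<forall>x\<in>closure \<Omega>. k x \<ge> \<kappa>" "\<forall>x\<in>closure \<Omega>. \<mu> x \<ge> 0"
    and "subspace V" "\<exists>B. finite B \<and> V \<subseteq> span B" "V \<subseteq> H1 \<Omega>"
    and "discrete_elliptic_operator V (elliptic_form \<Omega> k c \<mu>) A"
    and "smallest_eigenvalue_on V A lam1"
    and "eigenpair_on V A lam1 \<phi>\<^sub>1" "norm \<phi>\<^sub>1 = 1"
    and "A' = (\<lambda>v. A v - lam1 *\<^sub>R v)"
    and "\<tau> > 0" "N > 0" "real N * \<tau> = T"
    and "S = (\<lambda>v. exp (- lam1 * \<tau>) *\<^sub>R pade_op V l m (\<lambda>u. \<tau> *\<^sub>R A' u) v)"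
    and "w\<^sub>0 \<in> V" "y 0 = w\<^sub>0" "\<forall>n<N. y (Suc n) = S (y n)"
  shows "fundamental_mode_exact \<phi>\<^sub>1 lam1 \<tau> N y"
proof -
  interpret A: self_adjoint_on V A
    by (rule discrete_elliptic_operator_self_adjoint[OF assms(13,14,16) elliptic_form_sym])
  let ?B = "\<lambda>u. \<tau> *\<^sub>R A' u"
  interpret B: self_adjoint_on V ?B
  proof
    fix v w assume v: "v \<in> V"
    show "?B v \<in> V"
      unfolding assms(20) using v A.maps[OF v] A.subspace
      by (intro subspace_scale subspace_diff)
    assume w: "w \<in> V"
    show "inner (?B v) w = inner v (?B w)"
      unfolding assms(20) using A.sym[OF v w] by (simp add: inner_diff_left inner_diff_right)
  qed (fact A.subspace A.finite_dim)+
  have phi: "\<phi>\<^sub>1 \<in> V" "?B \<phi>\<^sub>1 = 0"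
    using assms(18) by (auto simp: eigenpair_on_def assms(20))
  have nonneg: "0 \<le> inner (?B u) u" if "u \<in> V" for u
    using A.Rayleigh_lower_bound[OF assms(17) that] assms(21)
    by (simp add: assms(20) inner_diff_left)
  note step = B.pade_op_kernel_component[OF _ phi]
  have yV: "y n \<in> V" if "n \<le> N" for n
    using that
  proof (induction n)
    case 0
    then show ?case using assms(25,26) by simp
  next
    case (Suc n)
    then show ?case
      using assms(27) step(1)[OF nonneg, of "y n" l m] A.subspace by (simp add: assms(24) subspace_scale)
  qed
  show ?thesis
    unfolding fundamental_mode_exact_def
  proof (intro allI impI)
    fix n assume n: "n < N"
    then show "inner (y (Suc n)) \<phi>\<^sub>1 = exp (- lam1 * \<tau>) * inner (y n) \<phi>\<^sub>1"
      using assms(27) step(2)[OF nonneg yV, of n l m] by (simp add: assms(24))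
  qed
qed

end
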